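(* Let $G$ be a finite simple graph on the vertex set $[n]=\{1,\ldots,n\}$, let $K$ be a field with $\operatorname{char} K \neq 2$, and let $\mathcal{I}_G \subseteq S = K[x_1,\ldots,x_n,y_1,\ldots,y_n]$ be the parity binomial edge ideal of $G$. If $\mathcal{I}_G^{(t)} = \mathcal{I}_G^t$ for every integer $t \geq 1$, then $\omega(G) \leq 3$, where $\omega(G)$ denotes the clique number of $G$.
   Context: For a finite simple graph $G$ with vertex set $V(G)=[n]$ and edge set $E(G)$, and a field $K$, let $S = K[x_1,\ldots,x_n,y_1,\ldots,y_n]$ be the polynomial ring in $2n$ variables. The parity binomial edge ideal of $G$ is $\mathcal{I}_G = (x_i x_j - y_i y_j : \{i,j\}\in E(G)) \subseteq S$. Symbolic powers: if $\mathfrak{p}_1,\ldots,\mathfrak{p}_r$ are the minimal primes of an ideal $I$ in a Noetherian ring, then the $m$-th symbolic power of $I$ is $I^{(m)} = \mathfrak{q}_1\cap\cdots\cap\mathfrak{q}_r$, where $\mathfrak{q}_i$ is the $\mathfrak{p}_i$-primary component of the ordinary power $I^m$. A clique of $G$ is a complete subgraph of $G$; the clique number $\omega(G)$ is the number of vertices in a maximum clique of $G$. *)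

theory Defs
  imports
    "HOL-Algebra.Algebraic_Closure_Type"
    "HOL-Algebra.Ideal_Product"
    "HOL-Library.Poly_Mapping"
    "HOL-Library.Ramsey"
begin

section \<open>Symbolic powers of ideals\<close>

definition ideal_radical :: "('a, 'b) ring_scheme \<Rightarrow> 'a set \<Rightarrow> 'a set" where
  "ideal_radical R I = {a \<in> carrier R. \<exists>n::nat. n > 0 \<and> a [^]\<^bsub>R\<^esub> n \<in> I}"

definition primary_ideal :: "('a, 'b) ring_scheme \<Rightarrow> 'a set \<Rightarrow> bool" where
  "primary_ideal R Q \<longleftrightarrow> ideal Q R \<and> Q \<noteq> carrier R \<and>
     (\<forall>a\<in>carrier R. \<forall>b\<in>carrier R. a \<otimes>\<^bsub>R\<^esub> b \<in> Q \<longrightarrow> a \<in> Q \<or> b \<in> ideal_radical R Q)"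

definition minimal_primes :: "('a, 'b) ring_scheme \<Rightarrow> 'a set \<Rightarrow> 'a set set" where
  "minimal_primes R I = {P. primeideal P R \<and> I \<subseteq> P \<and>
     (\<forall>P'. primeideal P' R \<and> I \<subseteq> P' \<and> P' \<subseteq> P \<longrightarrow> P' = P)}"

text \<open>Minimal primary decomposition: finitely many primary ideals with pairwise distinct
  radicals, none of which may be omitted. Intersecting with the carrier only matters for the
  empty family, whose intersection is the unit ideal.\<close>

definition minimal_primary_decomposition ::
    "('a, 'b) ring_scheme \<Rightarrow> 'a set \<Rightarrow> 'a set set \<Rightarrow> bool" where
  "minimal_primary_decomposition R I \<Q> \<longleftrightarrow>
     finite \<Q> \<and> (\<forall>Q\<in>\<Q>. primary_ideal R Q) \<and> carrier R \<inter> \<Inter>\<Q> = I \<and>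
     inj_on (ideal_radical R) \<Q> \<and> (\<forall>Q\<in>\<Q>. carrier R \<inter> \<Inter>(\<Q> - {Q}) \<noteq> I)"

definition is_primary_component ::
    "('a, 'b) ring_scheme \<Rightarrow> 'a set \<Rightarrow> 'a set \<Rightarrow> 'a set \<Rightarrow> bool" where
  "is_primary_component R I P Q \<longleftrightarrow>
     (\<exists>\<Q>. minimal_primary_decomposition R I \<Q> \<and> Q \<in> \<Q> \<and> ideal_radical R Q = P)"

text \<open>In a Noetherian ring and for \<open>m \<ge> 1\<close>, each minimal prime \<open>P\<close> of \<open>I\<close> is a minimal prime of
  the \<open>m\<close>-th power of \<open>I\<close>, so by the Lasker--Noether theorem and the second uniqueness theorem
  the latter has exactly one \<open>P\<close>-primary component \<open>Q\<close>. Hence the intersection below has one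
  member for each minimal prime of \<open>I\<close>.\<close>

definition symbolic_power :: "('a, 'b) ring_scheme \<Rightarrow> 'a set \<Rightarrow> nat \<Rightarrow> 'a set" where
  "symbolic_power R I m = carrier R \<inter>
     \<Inter>{Q. \<exists>P\<in>minimal_primes R I. is_primary_component R (I [^]\<^bsub>ideals_set R\<^esub> m) P Q}"

section \<open>Parity binomial edge ideals\<close>

text \<open>Polynomials over \<open>'k\<close> in the variables \<open>x\<^sub>i\<close> (index \<open>Inl i\<close>) and \<open>y\<^sub>i\<close> (index \<open>Inr i\<close>),
  as finitely supported maps from exponent vectors to coefficients; multiplication is
  convolution.\<close>

type_synonym ('n, 'k) xy_poly = "(('n + 'n) \<Rightarrow>\<^sub>0 nat) \<Rightarrow>\<^sub>0 'k"

definition x_var :: "'n \<Rightarrow> ('n, 'k::field) xy_poly" where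
  "x_var i = Poly_Mapping.single (Poly_Mapping.single (Inl i) 1) 1"

definition y_var :: "'n \<Rightarrow> ('n, 'k::field) xy_poly" where
  "y_var i = Poly_Mapping.single (Poly_Mapping.single (Inr i) 1) 1"

abbreviation xy_ring :: "('n, 'k::field) xy_poly ring" where
  "xy_ring \<equiv> ring_of_type_algebra"

definition parity_binomial_edge_ideal :: "'n set set \<Rightarrow> ('n, 'k::field) xy_poly set" where
  "parity_binomial_edge_ideal E =
     Idl\<^bsub>xy_ring\<^esub> {x_var i * x_var j - y_var i * y_var j | i j. {i, j} \<in> E}"

section \<open>Clique number\<close>

text \<open>The vertex set is the whole type \<open>'n\<close>.\<close>

definition clique_number :: "'n::finite set set \<Rightarrow> nat" where
  "clique_number E = Max (card ` {C. clique C E})"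

end

theory Submission
  imports Defs "HOL-Computational_Algebra.Polynomial"
begin

text \<open>
  A clique on four vertices already separates the second symbolic power from the square. Write
  \<open>u\<^sub>i = x\<^sub>i - y\<^sub>i\<close> and \<open>w\<^sub>i = x\<^sub>i + y\<^sub>i\<close>, so that the generator of an edge
  \<open>{i, j}\<close> is, up to the factor \<open>2\<close>, the permanent \<open>u\<^sub>i w\<^sub>j + w\<^sub>i u\<^sub>j\<close>. For a clique
  \<open>i\<^sub>1, i\<^sub>2, i\<^sub>3, i\<^sub>4\<close> the separating element is
  \<open>f = u\<^bsub>i\<^sub>1\<^esub> u\<^bsub>i\<^sub>2\<^esub> w\<^bsub>i\<^sub>3\<^esub> w\<^bsub>i\<^sub>4\<^esub>\<close>.

  To see that \<open>f\<close> lies in the second symbolic power of \<open>I\<close>, it suffices to multiply it into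
  \<open>I\<^sup>2\<close> by an element outside \<open>P\<close>, for each minimal prime \<open>P\<close> of \<open>I\<close>
  (\<open>symbolic_powerI\<close>). This holds as soon as two of the four factors of \<open>f\<close> lie in \<open>I\<close> locally
  at \<open>P\<close>. Call a vertex \<open>v\<close> dead if \<open>x\<^sub>v, y\<^sub>v \<in> P\<close> and live otherwise. Minimality of \<open>P\<close>
  forces a dead vertex to have two neighbours that impose independent linear conditions on
  \<open>(x\<^sub>v, y\<^sub>v)\<close>, and then Cramer's rule puts \<open>x\<^sub>v\<close> and \<open>y\<^sub>v\<close> into \<open>I\<close> locally at \<open>P\<close>
  (\<open>dead_vertex_local\<close>). On a triangle of live vertices, either all three \<open>u\<^sub>i\<close> or all three
  \<open>w\<^sub>i\<close> lie in \<open>I\<close> locally at \<open>P\<close> (\<open>live_triangle_local\<close>); here the characteristic enters.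
  So two dead vertices of the clique suffice, and otherwise the live vertices contain a triangle
  and are all of the same kind, which gives two factors again.

  To see that \<open>f \<notin> I\<^sup>2\<close>, note that every generator of \<open>I\<close> has only monomials with an even number
  of \<open>y\<close> factors, so the same holds for the part of lowest degree, four, of any element of
  \<open>I\<^sup>2\<close>, whereas \<open>f\<close> contains the monomial \<open>x\<^bsub>i\<^sub>1\<^esub> x\<^bsub>i\<^sub>2\<^esub> x\<^bsub>i\<^sub>3\<^esub> y\<^bsub>i\<^sub>4\<^esub>\<close>. This
  obstruction is detected by comparing two evaluations in a univariate polynomial ring
  (\<open>clique_witness_notin_square\<close>).
\<close>

section \<open>Ideals in the ring of a type\<close>

abbreviation (input) type_ring :: "'a::comm_ring_1 ring" where
  "type_ring \<equiv> ring_of_type_algebra"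

lemma type_ring_simps [simp]:
  "carrier type_ring = UNIV"
  "x \<otimes>\<^bsub>type_ring\<^esub> y = x * y"
  "x \<oplus>\<^bsub>type_ring\<^esub> y = x + y"
  "\<one>\<^bsub>type_ring\<^esub> = 1"
  "\<zero>\<^bsub>type_ring\<^esub> = 0"
  by (simp_all add: ring_of_type_algebra_def)

lemma a_inv_type_ring [simp]: "\<ominus>\<^bsub>type_ring\<^esub> (x :: 'a::comm_ring_1) = - x"
proof -
  interpret cring "type_ring :: 'a ring" by rule
  show ?thesis by (rule minus_equality) simp_all
qed

lemma ideal_type_ring_iff:
  "ideal I (type_ring :: 'a::comm_ring_1 ring) \<longleftrightarrow>
     0 \<in> I \<and> (\<forall>a\<in>I. \<forall>b\<in>I. a + b \<in> I) \<and> (\<forall>a\<in>I. \<forall>r. r * a \<in> I)"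
proof
  assume "ideal I (type_ring :: 'a ring)"
  then interpret ideal I "type_ring :: 'a ring" .
  show "0 \<in> I \<and> (\<forall>a\<in>I. \<forall>b\<in>I. a + b \<in> I) \<and> (\<forall>a\<in>I. \<forall>r. r * a \<in> I)"
    using additive_subgroup.zero_closed[OF is_additive_subgroup]
      additive_subgroup.a_closed[OF is_additive_subgroup] I_l_closed by simp
next
  interpret cring "type_ring :: 'a ring" by rule
  assume I: "0 \<in> I \<and> (\<forall>a\<in>I. \<forall>b\<in>I. a + b \<in> I) \<and> (\<forall>a\<in>I. \<forall>r. r * a \<in> I)"
  have "- a \<in> I" if "a \<in> I" for a
    using I that by (metis mult_minus1)
  then have "subgroup I (add_monoid type_ring)"
    using I unfolding subgroup_def a_inv_def[symmetric] by simp
  then show "ideal I (type_ring :: 'a ring)"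
    using I by (intro idealI ring_axioms) (simp_all add: mult.commute)
qed

lemma primeideal_type_ring_iff:
  "primeideal P (type_ring :: 'a::comm_ring_1 ring) \<longleftrightarrow>
     ideal P (type_ring :: 'a ring) \<and> 1 \<notin> P \<and> (\<forall>a b. a * b \<in> P \<longrightarrow> a \<in> P \<or> b \<in> P)"
proof
  assume "primeideal P (type_ring :: 'a ring)"
  then interpret primeideal P "type_ring :: 'a ring" .
  have "1 \<notin> P" using I_notcarr one_imp_carrier by auto
  then show "ideal P (type_ring :: 'a ring) \<and> 1 \<notin> P \<and> (\<forall>a b. a * b \<in> P \<longrightarrow> a \<in> P \<or> b \<in> P)"
    using is_ideal I_prime by simp
next
  assume "ideal P (type_ring :: 'a ring) \<and> 1 \<notin> P \<and> (\<forall>a b. a * b \<in> P \<longrightarrow> a \<in> P \<or> b \<in> P)"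
  then show "primeideal P (type_ring :: 'a ring)"
    by (intro primeidealI cring_from_type_algebra) auto
qed

lemma ideal_diff:
  fixes I :: "'a::comm_ring_1 set"
  assumes "ideal I type_ring" "a \<in> I" "b \<in> I"
  shows "a - b \<in> I"
  using assms unfolding ideal_type_ring_iff by (metis diff_conv_add_uminus mult_minus1)

lemma ideal_sum:
  fixes I :: "'a::comm_ring_1 set"
  assumes "ideal I type_ring" "\<And>i. i \<in> A \<Longrightarrow> g i \<in> I"
  shows "sum g A \<in> I"
  using assms(2)
  by (induction A rule: infinite_finite_induct)
    (use assms(1) in \<open>auto simp: ideal_type_ring_iff\<close>)

lemma mult_in_ideal_square:
  fixes I :: "'a::comm_ring_1 set"
  assumes "ideal I type_ring" "a \<in> I" "b \<in> I"
  shows "a * b \<in> I [^]\<^bsub>ideals_set type_ring\<^esub> (2::nat)"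
proof -
  have "1 * a \<in> ideal_prod type_ring UNIV I"
    using ideal_prod.prod[of 1 UNIV a I type_ring] assms by simp
  then show ?thesis
    using ideal_prod.prod[of a "ideal_prod type_ring UNIV I" b I type_ring] assms
    by (simp add: nat_pow_def ideals_set_def numeral_2_eq_2)
qed

lemma ideal_square_subset:
  fixes I A :: "'a::comm_ring_1 set"
  assumes "ideal I type_ring" "ideal A type_ring" "\<And>a b. a \<in> I \<Longrightarrow> b \<in> I \<Longrightarrow> a * b \<in> A"
  shows "I [^]\<^bsub>ideals_set type_ring\<^esub> (2::nat) \<subseteq> A"
proof -
  interpret cring "type_ring :: 'a ring" by rule
  have sub: "ideal_prod type_ring UNIV I \<subseteq> I"
    using ideal_prod_inter[OF oneideal assms(1)] by simp
  have "p \<in> A" if "p \<in> ideal_prod type_ring (ideal_prod type_ring UNIV I) I" for p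
    using that
  proof induction
    case (prod i j)
    then show ?case using sub assms(3) by auto
  next
    case (sum s1 s2)
    then show ?case using assms(2) by (simp add: ideal_type_ring_iff)
  qed
  then show ?thesis by (auto simp: nat_pow_def ideals_set_def numeral_2_eq_2)
qed

lemma ideal_square_ideal:
  fixes I :: "'a::comm_ring_1 set"
  assumes "ideal I type_ring"
  shows "ideal (I [^]\<^bsub>ideals_set type_ring\<^esub> (2::nat)) type_ring"
proof -
  interpret cring "type_ring :: 'a ring" by rule
  show ?thesis
    using ideal_prod_is_ideal[OF ideal_prod_is_ideal[OF oneideal assms] assms]
    by (simp add: nat_pow_def ideals_set_def numeral_2_eq_2)
qed

text \<open>This is Gauss's lemma: if neither factor has all its coefficients in \<open>P\<close>, take the lowest
  coefficients outside \<open>P\<close>, in degrees \<open>i\<close> and \<open>j\<close>. Modulo \<open>P\<close> their product is the coefficient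
  of the product in degree \<open>i + j\<close>.\<close>

lemma primeideal_coeffs:
  fixes P :: "'a::comm_ring_1 set"
  assumes "primeideal P type_ring"
  shows "primeideal {q. \<forall>n. Polynomial.coeff q n \<in> P} (type_ring :: 'a Polynomial.poly ring)"
    (is "primeideal ?Q _")
proof -
  have idP: "ideal P type_ring" and one: "1 \<notin> P"
    and prime: "\<And>a b. a * b \<in> P \<Longrightarrow> a \<in> P \<or> b \<in> P"
    using assms by (auto simp: primeideal_type_ring_iff)
  have P: "0 \<in> P" "\<And>a b. a \<in> P \<Longrightarrow> b \<in> P \<Longrightarrow> a + b \<in> P" "\<And>a r. a \<in> P \<Longrightarrow> r * a \<in> P"
    "\<And>a r. a \<in> P \<Longrightarrow> a * r \<in> P"
    using idP by (auto simp: ideal_type_ring_iff mult.commute)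
  have "ideal ?Q type_ring"
    using P by (auto simp: ideal_type_ring_iff coeff_mult intro!: ideal_sum[OF idP])
  moreover have "1 \<notin> ?Q" using one by (auto intro!: exI[of _ 0])
  moreover have "p \<in> ?Q \<or> q \<in> ?Q" if pq: "p * q \<in> ?Q" for p q
  proof (rule ccontr)
    assume "\<not> (p \<in> ?Q \<or> q \<in> ?Q)"
    then have ex: "\<exists>n. Polynomial.coeff p n \<notin> P" "\<exists>n. Polynomial.coeff q n \<notin> P" by auto
    define i where "i = (LEAST n. Polynomial.coeff p n \<notin> P)"
    define j where "j = (LEAST n. Polynomial.coeff q n \<notin> P)"
    have ij: "Polynomial.coeff p i \<notin> P" "Polynomial.coeff q j \<notin> P"
      unfolding i_def j_def using ex[THEN LeastI_ex] by blast+
    have less: "\<And>n. n < i \<Longrightarrow> Polynomial.coeff p n \<in> P" "\<And>n. n < j \<Longrightarrow> Polynomial.coeff q n \<in> P"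
      unfolding i_def j_def using not_less_Least by blast+
    let ?g = "\<lambda>k. Polynomial.coeff p k * Polynomial.coeff q (i + j - k)"
    have "Polynomial.coeff (p * q) (i + j) = sum ?g ({..i + j} - {i}) + ?g i"
      unfolding coeff_mult by (subst sum.remove[of _ i]) (auto simp: add.commute)
    moreover have "sum ?g ({..i + j} - {i}) \<in> P"
    proof (rule ideal_sum[OF idP])
      fix k assume "k \<in> {..i + j} - {i}"
      then have "k < i \<or> i + j - k < j" by auto
      then show "?g k \<in> P" using less P by blast
    qed
    ultimately have "?g i \<in> P"
      using pq ideal_diff[OF idP, of "Polynomial.coeff (p * q) (i + j)"] by fastforce
    then show False using ij prime by auto
  qed
  ultimately show ?thesis by (auto simp: primeideal_type_ring_iff)
qed

section \<open>Evaluation of multivariate polynomials\<close>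

text \<open>The map \<open>c\<close> on the coefficients is an arbitrary function, constrained only where it matters,
  so that one definition serves for every coefficient embedding into the target ring.\<close>

definition mpoly_eval ::
    "('k \<Rightarrow> 'r) \<Rightarrow> ('v \<Rightarrow> 'r) \<Rightarrow> (('v::finite \<Rightarrow>\<^sub>0 nat) \<Rightarrow>\<^sub>0 'k::comm_semiring_1) \<Rightarrow> 'r::comm_semiring_1"
  where "mpoly_eval c a g =
    (\<Sum>m\<in>Poly_Mapping.keys g. c (Poly_Mapping.lookup g m) * (\<Prod>v\<in>UNIV. a v ^ Poly_Mapping.lookup m v))"

lemma mpoly_eval_superset:
  assumes "c 0 = 0" "finite A" "Poly_Mapping.keys g \<subseteq> A"
  shows "mpoly_eval c a g =
    (\<Sum>m\<in>A. c (Poly_Mapping.lookup g m) * (\<Prod>v\<in>UNIV. a v ^ Poly_Mapping.lookup m v))"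
  unfolding mpoly_eval_def
  by (rule sum.mono_neutral_left) (use assms in \<open>auto simp: in_keys_iff\<close>)

lemma mpoly_eval_single:
  assumes "c 0 = 0"
  shows "mpoly_eval c a (Poly_Mapping.single m r) = c r * (\<Prod>v\<in>UNIV. a v ^ Poly_Mapping.lookup m v)"
  by (subst mpoly_eval_superset[where A = "{m}"]) (use assms in auto)

lemma mpoly_eval_var:
  assumes "c 0 = 0" "c 1 = 1"
  shows "mpoly_eval c a (Poly_Mapping.single (Poly_Mapping.single v 1) 1) = a v"
proof -
  have "(\<Prod>w\<in>UNIV. a w ^ Poly_Mapping.lookup (Poly_Mapping.single v (1::nat)) w) =
      (\<Prod>w\<in>UNIV. if w = v then a w else 1)"
    by (intro prod.cong) (auto simp: lookup_single)
  then show ?thesis using assms by (simp add: mpoly_eval_single)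
qed

lemma mpoly_eval_add:
  assumes "c 0 = 0" "\<And>r s. c (r + s) = c r + c s"
  shows "mpoly_eval c a (g + h) = mpoly_eval c a g + mpoly_eval c a h"
proof -
  let ?A = "Poly_Mapping.keys g \<union> Poly_Mapping.keys h"
  have "Poly_Mapping.keys (g + h) \<subseteq> ?A" by (rule keys_add)
  then show ?thesis
    using assms
    by (subst (1 2 3) mpoly_eval_superset[where A = ?A])
      (auto simp: lookup_add distrib_right sum.distrib)
qed

text \<open>Every polynomial is a sum of monomials, so identities that are additive on both sides
  need only be checked on monomials.\<close>

lemma poly_mapping_additive_induct [case_names single add]:
  assumes "\<And>m r. P (Poly_Mapping.single m (r :: 'k::comm_monoid_add))"
    and "\<And>g h. P g \<Longrightarrow> P h \<Longrightarrow> P (g + h)"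
  shows "P g"
proof (induction g rule: Poly_Mapping.update_induct)
  case const
  show ?case using assms(1)[of undefined 0] by simp
next
  case (update f m r)
  have "Poly_Mapping.update m r f = f + Poly_Mapping.single m r"
    using update by (intro poly_mapping_eqI)
      (auto simp: lookup_update lookup_add lookup_single in_keys_iff when_def)
  then show ?case using update assms by metis
qed

lemma mpoly_eval_mult:
  fixes c :: "'k::comm_semiring_1 \<Rightarrow> 'r::comm_semiring_1"
  assumes c: "c 0 = 0" "\<And>r s. c (r + s) = c r + c s" "\<And>r s. c (r * s) = c r * c s"
  shows "mpoly_eval c a (g * h) = mpoly_eval c a g * mpoly_eval c a h"
proof (induction g rule: poly_mapping_additive_induct)
  case (single m r)
  show ?case
  proof (induction h rule: poly_mapping_additive_induct)
    case (single m' r')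
    show ?case
      using c by (simp add: mult_single mpoly_eval_single lookup_add power_add prod.distrib ac_simps)
  next
    case (add g h)
    then show ?case using c by (simp add: distrib_left mpoly_eval_add)
  qed
next
  case (add g h)
  then show ?case using c by (simp add: distrib_right mpoly_eval_add)
qed

text \<open>The polynomial ring is generated as a ring by the constants and the variables, so two
  ring homomorphisms can be compared on these.\<close>

lemma mpoly_induct [case_names const var add mult]:
  fixes g :: "('v::finite \<Rightarrow>\<^sub>0 nat) \<Rightarrow>\<^sub>0 'k::comm_semiring_1"
  assumes const: "\<And>r. P (Poly_Mapping.single 0 r)"
    and var: "\<And>v. P (Poly_Mapping.single (Poly_Mapping.single v 1) 1)"
    and add: "\<And>g h. P g \<Longrightarrow> P h \<Longrightarrow> P (g + h)"
    and mult: "\<And>g h. P g \<Longrightarrow> P h \<Longrightarrow> P (g * h)"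
  shows "P g"
proof (induction g rule: poly_mapping_additive_induct)
  case (single m r)
  have monom: "P (Poly_Mapping.single m (1::'k))"
  proof (induction m rule: poly_mapping_additive_induct)
    case (single v n)
    show ?case
    proof (induction n)
      case 0
      show ?case using const[of 1] by simp
    next
      case (Suc n)
      have "Poly_Mapping.single (Poly_Mapping.single v (Suc n)) (1::'k) =
          Poly_Mapping.single (Poly_Mapping.single v 1) 1 * Poly_Mapping.single (Poly_Mapping.single v n) 1"
        by (simp add: mult_single flip: single_add)
      then show ?case using mult[OF var Suc] by metis
    qed
  next
    case (add m m')
    then show ?case using mult[OF add] by (simp add: mult_single)
  qed
  then show ?case using mult[OF const[of r] monom] by (simp add: mult_single)
next
  case (add g h)
  then show ?case by (rule assms(3))
qed


section \<open>Minimal primes of parity binomial edge ideals\<close>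

text \<open>The elements of the ring whose image in the localization at \<open>P\<close> lies in the extension of
  \<open>I\<close>.\<close>

definition local_contraction :: "'a::comm_ring_1 set \<Rightarrow> 'a set \<Rightarrow> 'a set" where
  "local_contraction P I = {a. \<exists>s. s \<notin> P \<and> s * a \<in> I}"

lemma local_contractionI: "s \<notin> P \<Longrightarrow> s * a \<in> I \<Longrightarrow> a \<in> local_contraction P I"
  by (auto simp: local_contraction_def)

lemma local_contraction_subset:
  assumes "primeideal P type_ring" "I \<subseteq> P"
  shows "local_contraction P I \<subseteq> P"
  using assms by (auto simp: local_contraction_def primeideal_type_ring_iff)

lemma local_contraction_add_diff:
  fixes I :: "'a::comm_ring_1 set"
  assumes P: "primeideal P type_ring" and I: "ideal I type_ring"
    and a: "a \<in> local_contraction P I" and b: "b \<in> local_contraction P I"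
  shows "a + b \<in> local_contraction P I" "a - b \<in> local_contraction P I"
proof -
  obtain s t where st: "s \<notin> P" "s * a \<in> I" "t \<notin> P" "t * b \<in> I"
    using a b by (auto simp: local_contraction_def)
  have "s * t \<notin> P" using P st by (auto simp: primeideal_type_ring_iff)
  moreover have "t * (s * a) \<in> I" "s * (t * b) \<in> I"
    using I st by (auto simp: ideal_type_ring_iff)
  then have "t * (s * a) + s * (t * b) \<in> I" "t * (s * a) - s * (t * b) \<in> I"
    using I ideal_diff[OF I] by (auto simp: ideal_type_ring_iff)
  then have "(s * t) * (a + b) \<in> I" "(s * t) * (a - b) \<in> I" by (simp_all add: algebra_simps)
  ultimately show "a + b \<in> local_contraction P I" "a - b \<in> local_contraction P I"
    by (auto intro: local_contractionI)
qed

lemma local_contraction_mult_square: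
  fixes I :: "'a::comm_ring_1 set"
  assumes P: "primeideal P type_ring" and I: "ideal I type_ring"
    and a: "a \<in> local_contraction P I" and b: "b \<in> local_contraction P I"
  shows "r * (a * b) \<in> local_contraction P (I [^]\<^bsub>ideals_set type_ring\<^esub> (2::nat))"
proof -
  obtain s t where st: "s \<notin> P" "s * a \<in> I" "t \<notin> P" "t * b \<in> I"
    using a b by (auto simp: local_contraction_def)
  have "s * t \<notin> P" using P st by (auto simp: primeideal_type_ring_iff)
  moreover have "r * (s * a * (t * b)) \<in> I [^]\<^bsub>ideals_set type_ring\<^esub> (2::nat)"
    using mult_in_ideal_square[OF I st(2,4)] ideal_square_ideal[OF I]
    by (simp add: ideal_type_ring_iff)
  then have "s * t * (r * (a * b)) \<in> I [^]\<^bsub>ideals_set type_ring\<^esub> (2::nat)"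
    by (simp add: ac_simps)
  ultimately show ?thesis by (rule local_contractionI)
qed

text \<open>A \<open>P\<close>-primary ideal that contains \<open>s f\<close> with \<open>s \<notin> P\<close> contains \<open>f\<close>. This gives membership
  in a symbolic power without having to exhibit a primary decomposition.\<close>

lemma symbolic_powerI:
  fixes I :: "'a::comm_ring_1 set"
  assumes "\<And>P. P \<in> minimal_primes type_ring I \<Longrightarrow>
    f \<in> local_contraction P (I [^]\<^bsub>ideals_set type_ring\<^esub> m)"
  shows "f \<in> symbolic_power type_ring I m"
  unfolding symbolic_power_def
proof (intro IntI InterI; clarify?)
  fix Q P assume P: "P \<in> minimal_primes type_ring I"
    and "is_primary_component type_ring (I [^]\<^bsub>ideals_set type_ring\<^esub> m) P Q"
  then have Q: "primary_ideal type_ring Q" "I [^]\<^bsub>ideals_set type_ring\<^esub> m \<subseteq> Q"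
      "ideal_radical type_ring Q = P"
    by (auto simp: is_primary_component_def minimal_primary_decomposition_def)
  obtain s where "s \<notin> P" "s * f \<in> I [^]\<^bsub>ideals_set type_ring\<^esub> m"
    using assms[OF P] by (auto simp: local_contraction_def)
  then have "f * s \<in> Q" "s \<notin> ideal_radical type_ring Q"
    using Q by (auto simp: mult.commute)
  then show "f \<in> Q" using Q(1) by (auto simp: primary_ideal_def)
qed simp

lemma ideal_parity_binomial_edge_ideal: "ideal (parity_binomial_edge_ideal E :: ('n, 'k::field) xy_poly set) xy_ring"
proof -
  interpret cring "xy_ring :: ('n, 'k::field) xy_poly ring" by rule
  show ?thesis
    unfolding parity_binomial_edge_ideal_def by (rule genideal_ideal) simp
qed

lemma parity_binomial_in_ideal:
  assumes "{i, j} \<in> E"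
  shows "x_var i * x_var j - y_var i * y_var j \<in> (parity_binomial_edge_ideal E :: ('n, 'k::field) xy_poly set)"
proof -
  interpret cring "xy_ring :: ('n, 'k) xy_poly ring" by rule
  show ?thesis
    using assms genideal_self
    unfolding parity_binomial_edge_ideal_def by fastforce
qed

lemma parity_binomial_edge_ideal_subset:
  fixes A :: "('n, 'k::field) xy_poly set"
  assumes "ideal A xy_ring"
    and "\<And>i j. {i, j} \<in> E \<Longrightarrow> x_var i * x_var j - y_var i * y_var j \<in> A"
  shows "parity_binomial_edge_ideal E \<subseteq> A"
proof -
  interpret cring "xy_ring :: ('n, 'k) xy_poly ring" by rule
  show ?thesis
    unfolding parity_binomial_edge_ideal_def
    by (rule genideal_minimal) (use assms in auto)
qed

lemma primeideal_mpoly_eval_vimage: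
  fixes c :: "'k::comm_ring_1 \<Rightarrow> 'r::comm_ring_1"
    and a :: "'v::finite \<Rightarrow> 'r"
  assumes c: "c 0 = 0" "c 1 = 1" "\<And>r s. c (r + s) = c r + c s" "\<And>r s. c (r * s) = c r * c s"
    and P: "primeideal P type_ring"
  shows "primeideal {g. mpoly_eval c a g \<in> P} type_ring"
proof -
  have "mpoly_eval c a 0 = 0" by (simp add: mpoly_eval_def)
  moreover have "mpoly_eval c a 1 = 1"
    using mpoly_eval_single[of c a 0 1] c by simp
  ultimately show ?thesis
    using P c by (auto simp: primeideal_type_ring_iff ideal_type_ring_iff mpoly_eval_add mpoly_eval_mult)
qed

text \<open>If the linear conditions that the neighbours of \<open>v\<close> impose on \<open>(x\<^sub>v, y\<^sub>v)\<close> were dependent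
  modulo \<open>P\<close>, they would have a common solution \<open>(\<alpha>, \<beta>)\<close> that is nonzero modulo \<open>P\<close>. Moving \<open>v\<close>
  along the line \<open>\<tau> (\<alpha>, \<beta>)\<close> then deforms the generic point of \<open>P\<close> inside the zero set of the edge
  ideal. Algebraically, the polynomials that vanish along this deformation form a prime ideal
  between the edge ideal and \<open>P\<close> and strictly smaller than \<open>P\<close>, against minimality.\<close>

lemma dead_vertex_has_independent_neighbours:
  fixes E :: "'n::finite set set" and P :: "('n, 'k::field) xy_poly set"
  assumes simple: "\<forall>e\<in>E. card e = 2"
    and min: "P \<in> minimal_primes xy_ring (parity_binomial_edge_ideal E)"
    and dead: "x_var v \<in> P" "y_var v \<in> P"
  obtains j k where "{v, j} \<in> E" "{v, k} \<in> E" "x_var j * y_var k - y_var j * x_var k \<notin> P"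
proof (rule ccontr)
  assume "\<not> thesis"
  then have dep: "x_var j * y_var k - y_var j * x_var k \<in> P" if "{v, j} \<in> E" "{v, k} \<in> E" for j k
    using that \<open>\<And>j k. \<lbrakk>{v, j} \<in> E; {v, k} \<in> E; x_var j * y_var k - y_var j * x_var k \<notin> P\<rbrakk> \<Longrightarrow> thesis\<close>
    by blast
  have P: "primeideal P xy_ring" and sub: "parity_binomial_edge_ideal E \<subseteq> P"
    and minP: "\<And>P'. primeideal P' xy_ring \<Longrightarrow> parity_binomial_edge_ideal E \<subseteq> P' \<Longrightarrow> P' \<subseteq> P \<Longrightarrow> P' = P"
    using min by (auto simp: minimal_primes_def)
  have idP: "ideal P xy_ring" and one: "1 \<notin> P"
    and closed: "\<And>a b. a \<in> P \<Longrightarrow> b \<in> P \<Longrightarrow> a + b \<in> P" "\<And>a r. a \<in> P \<Longrightarrow> r * a \<in> P" "0 \<in> P"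
    using P by (auto simp: primeideal_type_ring_iff ideal_type_ring_iff)
  \<comment> \<open>A live neighbour \<open>k\<close> determines the line of solutions, spanned by \<open>(y\<^sub>k, x\<^sub>k)\<close>. If no
    neighbour is live, there is no condition modulo \<open>P\<close> and any nonzero vector serves.\<close>
  obtain \<alpha> \<beta> where live: "\<alpha> \<notin> P \<or> \<beta> \<notin> P"
    and dir: "\<And>j. {v, j} \<in> E \<Longrightarrow> x_var j * \<alpha> - y_var j * \<beta> \<in> P"
  proof (cases "\<exists>k. {v, k} \<in> E \<and> (x_var k \<notin> P \<or> y_var k \<notin> P)")
    case True
    then obtain k where "{v, k} \<in> E" "x_var k \<notin> P \<or> y_var k \<notin> P" by blast
    then show thesis using that[of "y_var k" "x_var k"] dep by auto
  next
    case False
    then show thesis using that[of 1 1] one ideal_diff[OF idP] by auto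
  qed
  \<comment> \<open>The deformation: \<open>(x\<^sub>v, y\<^sub>v)\<close> goes to \<open>(\<alpha> \<tau>, \<beta> \<tau>)\<close>, all other variables are fixed. The
    indeterminate \<open>\<tau>\<close> is that of univariate polynomials over the ring itself.\<close>
  define c :: "'k \<Rightarrow> ('n, 'k) xy_poly Polynomial.poly" where "c = (\<lambda>r. [:Poly_Mapping.single 0 r:])"
  define a :: "'n + 'n \<Rightarrow> ('n, 'k) xy_poly Polynomial.poly" where
    "a = (\<lambda>w. if w = Inl v then [:0, \<alpha>:] else if w = Inr v then [:0, \<beta>:]
      else [:Poly_Mapping.single (Poly_Mapping.single w 1) 1:])"
  have c: "c 0 = 0" "c 1 = 1" "\<And>r s. c (r + s) = c r + c s" "\<And>r s. c (r * s) = c r * c s"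
    by (simp_all add: c_def single_add mult_single one_pCons mult.commute)
  let ?\<phi> = "mpoly_eval c a"
  define P' where "P' = {g. ?\<phi> g \<in> {q. \<forall>n. Polynomial.coeff q n \<in> P}}"
  have prime': "primeideal P' xy_ring"
    unfolding P'_def by (rule primeideal_mpoly_eval_vimage[OF c primeideal_coeffs[OF P]])
  have ev_x: "?\<phi> (x_var i) = (if i = v then [:0, \<alpha>:] else [:x_var i:])" for i
    unfolding x_var_def by (subst mpoly_eval_var[OF c(1,2)]) (auto simp: a_def)
  have ev_y: "?\<phi> (y_var i) = (if i = v then [:0, \<beta>:] else [:y_var i:])" for i
    unfolding y_var_def by (subst mpoly_eval_var[OF c(1,2)]) (auto simp: a_def)
  have ideal': "ideal P' xy_ring" using prime' by (simp add: primeideal_type_ring_iff)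
  have ev_diff: "?\<phi> (g - h) = ?\<phi> g - ?\<phi> h" for g h
    using mpoly_eval_add[OF c(1,3), of a "g - h" h] by (simp add: algebra_simps)
  have "parity_binomial_edge_ideal E \<subseteq> P'"
  proof (rule parity_binomial_edge_ideal_subset[OF ideal'])
    fix i j assume e: "{i, j} \<in> E"
    have "i \<noteq> j" using e simple by fastforce
    have d: "\<alpha> * x_var j - \<beta> * y_var j \<in> P" if "i = v"
      using dir[of j] e that by (simp add: mult.commute)
    have d': "x_var i * \<alpha> - y_var i * \<beta> \<in> P" if "j = v"
      using dir[of i] e that by (simp add: insert_commute)
    have "x_var i * x_var j - y_var i * y_var j \<in> P"
      using sub parity_binomial_in_ideal[OF e] by blast
    then show "x_var i * x_var j - y_var i * y_var j \<in> P'"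
      using \<open>i \<noteq> j\<close> d d' closed(3)
      by (auto simp: P'_def ev_diff ev_x ev_y mpoly_eval_mult[OF c(1,3,4)] coeff_pCons mult.commute split: nat.splits)
  qed
  moreover have "P' \<subseteq> P"
  proof
    fix g assume "g \<in> P'"
    \<comment> \<open>At \<open>\<tau> = 0\<close> the deformation is the original generic point, where \<open>v\<close> is dead.\<close>
    have "Polynomial.coeff (?\<phi> g) 0 - g \<in> P"
    proof (induction g rule: mpoly_induct)
      case (const r)
      show ?case using closed(3) c by (simp add: mpoly_eval_single c_def)
    next
      case (var w)
      have "Polynomial.coeff (?\<phi> (x_var i)) 0 - x_var i \<in> P" for i
        using closed(3) ideal_diff[OF idP closed(3) dead(1)] by (simp add: ev_x)
      moreover have "Polynomial.coeff (?\<phi> (y_var i)) 0 - y_var i \<in> P" for i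
        using closed(3) ideal_diff[OF idP closed(3) dead(2)] by (simp add: ev_y)
      ultimately show ?case
        unfolding x_var_def y_var_def by (cases w) auto
    next
      case (add g h)
      then show ?case using closed(1)[OF add] by (simp add: mpoly_eval_add[OF c(1,3)] algebra_simps)
    next
      case (mult g h)
      have "Polynomial.coeff (?\<phi> h) 0 * (Polynomial.coeff (?\<phi> g) 0 - g) + g * (Polynomial.coeff (?\<phi> h) 0 - h) \<in> P"
        using mult closed by blast
      then show ?case by (simp add: mpoly_eval_mult[OF c(1,3,4)] algebra_simps coeff_mult_0)
    qed
    moreover have "Polynomial.coeff (?\<phi> g) 0 \<in> P" using \<open>g \<in> P'\<close> by (auto simp: P'_def)
    ultimately show "g \<in> P" using ideal_diff[OF idP] by fastforce
  qed
  ultimately have "P' = P" by (rule minP[OF prime'])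
  then have "?\<phi> (x_var v) \<in> {q. \<forall>n. Polynomial.coeff q n \<in> P}" "?\<phi> (y_var v) \<in> {q. \<forall>n. Polynomial.coeff q n \<in> P}"
    using dead by (auto simp: P'_def)
  then have "Polynomial.coeff [:0, \<alpha>:] 1 \<in> P" "Polynomial.coeff [:0, \<beta>:] 1 \<in> P"
    unfolding ev_x ev_y if_P[OF refl] by blast+
  then show False using live by simp
qed

text \<open>By Cramer's rule, the determinant of the conditions of two independent neighbours, which is a
  unit locally at \<open>P\<close>, multiplies \<open>x\<^sub>v\<close> and \<open>y\<^sub>v\<close> into the edge ideal.\<close>

lemma dead_vertex_local:
  fixes E :: "'n::finite set set" and P :: "('n, 'k::field) xy_poly set"
  defines "I \<equiv> parity_binomial_edge_ideal E"
  assumes simple: "\<forall>e\<in>E. card e = 2"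
    and min: "P \<in> minimal_primes xy_ring I"
    and dead: "x_var v \<in> P" "y_var v \<in> P"
  shows "x_var v \<in> local_contraction P I" "y_var v \<in> local_contraction P I"
proof -
  obtain j k where e: "{v, j} \<in> E" "{v, k} \<in> E"
    and s: "x_var j * y_var k - y_var j * x_var k \<notin> P"
    using dead_vertex_has_independent_neighbours[OF simple min[unfolded I_def] dead] .
  have I: "ideal I xy_ring" "\<And>a r. a \<in> I \<Longrightarrow> r * a \<in> I"
    using ideal_parity_binomial_edge_ideal[of E] by (auto simp: I_def ideal_type_ring_iff)
  have b: "x_var v * x_var j - y_var v * y_var j \<in> I" "x_var v * x_var k - y_var v * y_var k \<in> I"
    unfolding I_def by (rule parity_binomial_in_ideal; fact)+
  have "y_var k * (x_var v * x_var j - y_var v * y_var j) - y_var j * (x_var v * x_var k - y_var v * y_var k) \<in> I"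
    by (intro ideal_diff I b)
  then have "(x_var j * y_var k - y_var j * x_var k) * x_var v \<in> I" by (simp add: algebra_simps)
  then show "x_var v \<in> local_contraction P I" using s by (rule local_contractionI[rotated])
  have "x_var k * (x_var v * x_var j - y_var v * y_var j) - x_var j * (x_var v * x_var k - y_var v * y_var k) \<in> I"
    by (intro ideal_diff I b)
  then have "(x_var j * y_var k - y_var j * x_var k) * y_var v \<in> I" by (simp add: algebra_simps)
  then show "y_var v \<in> local_contraction P I" using s by (rule local_contractionI[rotated])
qed

text \<open>With \<open>u\<^sub>i = x\<^sub>i - y\<^sub>i\<close> and \<open>w\<^sub>i = x\<^sub>i + y\<^sub>i\<close>, the sums of any two of \<open>u\<^sub>1 w\<^sub>2 w\<^sub>3\<close>,
  \<open>w\<^sub>1 u\<^sub>2 w\<^sub>3\<close>, \<open>w\<^sub>1 w\<^sub>2 u\<^sub>3\<close> are twice multiples of the three generators. Adding two of these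
  sums and subtracting the third isolates one product, and the factor \<open>2\<close> cancels.\<close>

lemma triangle_products:
  fixes x\<^sub>1 :: "'a::comm_ring_1"
  assumes I: "ideal I type_ring"
    and e: "x\<^sub>1 * x\<^sub>2 - y\<^sub>1 * y\<^sub>2 \<in> I" "x\<^sub>1 * x\<^sub>3 - y\<^sub>1 * y\<^sub>3 \<in> I" "x\<^sub>2 * x\<^sub>3 - y\<^sub>2 * y\<^sub>3 \<in> I"
  shows "(x\<^sub>2 + y\<^sub>2) * (x\<^sub>3 + y\<^sub>3) * (x\<^sub>1 - y\<^sub>1) \<in> I" "(x\<^sub>2 - y\<^sub>2) * (x\<^sub>3 - y\<^sub>3) * (x\<^sub>1 + y\<^sub>1) \<in> I"
proof -
  have I': "\<And>a b. a \<in> I \<Longrightarrow> b \<in> I \<Longrightarrow> a + b \<in> I" "\<And>a r. a \<in> I \<Longrightarrow> r * a \<in> I"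
    using I by (auto simp: ideal_type_ring_iff)
  have "(x\<^sub>3 + y\<^sub>3) * (x\<^sub>1 * x\<^sub>2 - y\<^sub>1 * y\<^sub>2) + (x\<^sub>2 + y\<^sub>2) * (x\<^sub>1 * x\<^sub>3 - y\<^sub>1 * y\<^sub>3)
      - (x\<^sub>1 + y\<^sub>1) * (x\<^sub>2 * x\<^sub>3 - y\<^sub>2 * y\<^sub>3) \<in> I"
    by (intro ideal_diff[OF I] I' e)
  then show "(x\<^sub>2 + y\<^sub>2) * (x\<^sub>3 + y\<^sub>3) * (x\<^sub>1 - y\<^sub>1) \<in> I" by (simp add: algebra_simps)
  have "(x\<^sub>3 - y\<^sub>3) * (x\<^sub>1 * x\<^sub>2 - y\<^sub>1 * y\<^sub>2) + (x\<^sub>2 - y\<^sub>2) * (x\<^sub>1 * x\<^sub>3 - y\<^sub>1 * y\<^sub>3)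
      - (x\<^sub>1 - y\<^sub>1) * (x\<^sub>2 * x\<^sub>3 - y\<^sub>2 * y\<^sub>3) \<in> I"
    by (intro ideal_diff[OF I] I' e)
  then show "(x\<^sub>2 - y\<^sub>2) * (x\<^sub>3 - y\<^sub>3) * (x\<^sub>1 + y\<^sub>1) \<in> I" by (simp add: algebra_simps)
qed

text \<open>As \<open>2 \<notin> P\<close>, at a live vertex not both of \<open>x\<^sub>i - y\<^sub>i\<close> and \<open>x\<^sub>i + y\<^sub>i\<close> are in \<open>P\<close>, so one
  of the two signs is outside \<open>P\<close> at two vertices of the triangle. Dividing the products of
  \<open>triangle_products\<close> by these two factors puts the opposite sign at the third vertex into \<open>I\<close>
  locally at \<open>P\<close>. That opposite sign is therefore in \<open>P\<close>, so at
  the live third vertex the first sign is outside \<open>P\<close>, and the argument applies to the others.\<close>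

lemma live_triangle_local:
  fixes x y :: "'v \<Rightarrow> 'a::comm_ring_1"
  assumes P: "primeideal P type_ring" and I: "ideal I type_ring" "I \<subseteq> P"
    and two: "(2::'a) \<notin> P"
    and e: "\<And>i j. i \<in> {i\<^sub>1, i\<^sub>2, i\<^sub>3} \<Longrightarrow> j \<in> {i\<^sub>1, i\<^sub>2, i\<^sub>3} \<Longrightarrow> i \<noteq> j \<Longrightarrow> x i * x j - y i * y j \<in> I"
    and distinct: "i\<^sub>1 \<noteq> i\<^sub>2" "i\<^sub>1 \<noteq> i\<^sub>3" "i\<^sub>2 \<noteq> i\<^sub>3"
    and live: "\<And>i. i \<in> {i\<^sub>1, i\<^sub>2, i\<^sub>3} \<Longrightarrow> x i \<notin> P \<or> y i \<notin> P"
  shows "(\<forall>i\<in>{i\<^sub>1, i\<^sub>2, i\<^sub>3}. x i - y i \<in> local_contraction P I) \<or>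
         (\<forall>i\<in>{i\<^sub>1, i\<^sub>2, i\<^sub>3}. x i + y i \<in> local_contraction P I)"
proof -
  let ?U = "\<lambda>i. x i - y i \<in> local_contraction P I"
  let ?W = "\<lambda>i. x i + y i \<in> local_contraction P I"
  have prime: "\<And>a b. a * b \<in> P \<Longrightarrow> a \<in> P \<or> b \<in> P"
    and idP: "ideal P type_ring"
    using P by (auto simp: primeideal_type_ring_iff)
  have liveUW: "x i - y i \<notin> P \<or> x i + y i \<notin> P" if "i \<in> {i\<^sub>1, i\<^sub>2, i\<^sub>3}" for i
  proof (rule ccontr)
    assume *: "\<not> ?thesis"
    have "(x i + y i) + (x i - y i) \<in> P"
      using * idP unfolding ideal_type_ring_iff by blast
    moreover have "(x i + y i) - (x i - y i) \<in> P"
      using * ideal_diff[OF idP] by blast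
    moreover have "(x i + y i) + (x i - y i) = 2 * x i" "(x i + y i) - (x i - y i) = 2 * y i"
      by simp_all
    ultimately have "2 * x i \<in> P" "2 * y i \<in> P" by metis+
    then show False using prime[of 2 "x i"] prime[of 2 "y i"] two live[OF that] by blast
  qed
  note sub = subsetD[OF local_contraction_subset[OF P I(2)]]
  have step: "(x j + y j \<notin> P \<longrightarrow> x k + y k \<notin> P \<longrightarrow> ?U i) \<and> (x j - y j \<notin> P \<longrightarrow> x k - y k \<notin> P \<longrightarrow> ?W i)"
    if "{i, j, k} \<subseteq> {i\<^sub>1, i\<^sub>2, i\<^sub>3}" "i \<noteq> j" "i \<noteq> k" "j \<noteq> k" for i j k
  proof -
    have "x i * x j - y i * y j \<in> I" "x i * x k - y i * y k \<in> I" "x j * x k - y j * y k \<in> I"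
      by (intro e; use that in blast)+
    note T = triangle_products[OF I(1) this]
    show ?thesis
      using T(1)[THEN local_contractionI[rotated], of P] T(2)[THEN local_contractionI[rotated], of P] prime
      by meson
  qed
  have s: "(x i\<^sub>2 + y i\<^sub>2 \<notin> P \<longrightarrow> x i\<^sub>3 + y i\<^sub>3 \<notin> P \<longrightarrow> ?U i\<^sub>1) \<and> (x i\<^sub>2 - y i\<^sub>2 \<notin> P \<longrightarrow> x i\<^sub>3 - y i\<^sub>3 \<notin> P \<longrightarrow> ?W i\<^sub>1)"
    "(x i\<^sub>1 + y i\<^sub>1 \<notin> P \<longrightarrow> x i\<^sub>3 + y i\<^sub>3 \<notin> P \<longrightarrow> ?U i\<^sub>2) \<and> (x i\<^sub>1 - y i\<^sub>1 \<notin> P \<longrightarrow> x i\<^sub>3 - y i\<^sub>3 \<notin> P \<longrightarrow> ?W i\<^sub>2)"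
    "(x i\<^sub>1 + y i\<^sub>1 \<notin> P \<longrightarrow> x i\<^sub>2 + y i\<^sub>2 \<notin> P \<longrightarrow> ?U i\<^sub>3) \<and> (x i\<^sub>1 - y i\<^sub>1 \<notin> P \<longrightarrow> x i\<^sub>2 - y i\<^sub>2 \<notin> P \<longrightarrow> ?W i\<^sub>3)"
    using distinct by (intro step; auto)+
  have l: "x i\<^sub>1 - y i\<^sub>1 \<notin> P \<or> x i\<^sub>1 + y i\<^sub>1 \<notin> P" "x i\<^sub>2 - y i\<^sub>2 \<notin> P \<or> x i\<^sub>2 + y i\<^sub>2 \<notin> P"
    "x i\<^sub>3 - y i\<^sub>3 \<notin> P \<or> x i\<^sub>3 + y i\<^sub>3 \<notin> P"
    by (rule liveUW; simp)+
  have "(?U i\<^sub>1 \<and> ?U i\<^sub>2 \<and> ?U i\<^sub>3) \<or> (?W i\<^sub>1 \<and> ?W i\<^sub>2 \<and> ?W i\<^sub>3)"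
    using s l sub[of "x i\<^sub>1 - y i\<^sub>1"] sub[of "x i\<^sub>1 + y i\<^sub>1"]
      sub[of "x i\<^sub>2 - y i\<^sub>2"] sub[of "x i\<^sub>2 + y i\<^sub>2"]
      sub[of "x i\<^sub>3 - y i\<^sub>3"] sub[of "x i\<^sub>3 + y i\<^sub>3"] by sat
  then show ?thesis by simp
qed

section \<open>A polynomial separating the second symbolic power from the square\<close>

text \<open>Any choice of two minus and two plus signs would do. The six choices are linearly independent,
  whereas the part of the square of the edge ideal in their multidegree is spanned by only three
  elements, the products of the generators of two opposite edges of the clique.\<close>

definition clique_witness :: "'n \<Rightarrow> 'n \<Rightarrow> 'n \<Rightarrow> 'n \<Rightarrow> ('n, 'k::field) xy_poly" where
  "clique_witness i\<^sub>1 i\<^sub>2 i\<^sub>3 i\<^sub>4 =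
    (x_var i\<^sub>1 - y_var i\<^sub>1) * (x_var i\<^sub>2 - y_var i\<^sub>2) * (x_var i\<^sub>3 + y_var i\<^sub>3) * (x_var i\<^sub>4 + y_var i\<^sub>4)"

lemma clique_witness_in_symbolic_square:
  fixes E :: "'n::finite set set" and I :: "('n, 'k::field) xy_poly set"
  defines "I \<equiv> parity_binomial_edge_ideal E"
  assumes simple: "\<forall>e\<in>E. card e = 2" and char: "CHAR('k) \<noteq> 2"
    and clique: "clique {i\<^sub>1, i\<^sub>2, i\<^sub>3, i\<^sub>4} E" and distinct: "distinct [i\<^sub>1, i\<^sub>2, i\<^sub>3, i\<^sub>4]"
  shows "clique_witness i\<^sub>1 i\<^sub>2 i\<^sub>3 i\<^sub>4 \<in> symbolic_power xy_ring I 2"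
proof (rule symbolic_powerI)
  fix P assume min: "P \<in> minimal_primes xy_ring I"
  then have P: "primeideal P xy_ring" and sub: "I \<subseteq> P" by (auto simp: minimal_primes_def)
  have I: "ideal I xy_ring" unfolding I_def by (rule ideal_parity_binomial_edge_ideal)
  have "(2::'k) \<noteq> 0"
  proof
    assume "(2::'k) = 0"
    then have "CHAR('k) dvd 2" using of_nat_eq_0_iff_char_dvd[where ?'a = 'k, of 2] by simp
    then show False using char dvd_imp_le[of "CHAR('k)" 2] CHAR_not_1'[where ?'a = 'k]
      by (cases "CHAR('k)") (auto simp: le_Suc_eq numeral_2_eq_2)
  qed
  have two: "2 \<notin> P"
  proof
    assume "2 \<in> P"
    then have "Poly_Mapping.single 0 (inverse 2) * 2 \<in> P"
      using P by (auto simp: primeideal_type_ring_iff ideal_type_ring_iff)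
    moreover have "Poly_Mapping.single 0 (inverse 2) * 2 = (1 :: ('n, 'k) xy_poly)"
      unfolding single_numeral[symmetric] mult_single using \<open>(2::'k) \<noteq> 0\<close> by simp
    ultimately show False using P by (auto simp: primeideal_type_ring_iff)
  qed
  let ?D = "\<lambda>i. x_var i \<in> P \<and> y_var i \<in> P"
  let ?U = "\<lambda>i. x_var i - y_var i \<in> local_contraction P I"
  let ?W = "\<lambda>i. x_var i + y_var i \<in> local_contraction P I"
  have dead: "?U i \<and> ?W i" if "?D i" for i
    using dead_vertex_local[OF simple min[unfolded I_def]] that
      local_contraction_add_diff[OF P I] by (auto simp: I_def)
  have triangle: "?D i \<or> ?D j \<or> ?D k \<or> ?U i \<and> ?U j \<and> ?U k \<or> ?W i \<and> ?W j \<and> ?W k"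
    if "{i, j, k} \<subseteq> {i\<^sub>1, i\<^sub>2, i\<^sub>3, i\<^sub>4}" "i \<noteq> j" "i \<noteq> k" "j \<noteq> k" for i j k
  proof -
    have e: "x_var p * x_var q - y_var p * y_var q \<in> I" if "p \<in> {i, j, k}" "q \<in> {i, j, k}" "p \<noteq> q" for p q
      unfolding I_def
    proof (rule parity_binomial_in_ideal)
      show "{p, q} \<in> E" using that \<open>{i, j, k} \<subseteq> _\<close> clique unfolding clique_def by blast
    qed
    show ?thesis
    proof (cases "?D i \<or> ?D j \<or> ?D k")
      case False
      then have "x_var p \<notin> P \<or> y_var p \<notin> P" if "p \<in> {i, j, k}" for p
        using that by blast
      from live_triangle_local[where x = x_var and y = y_var,
          OF P I sub two e \<open>i \<noteq> j\<close> \<open>i \<noteq> k\<close> \<open>j \<noteq> k\<close> this]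
      show ?thesis by simp
    qed blast
  qed
  \<comment> \<open>At dead vertices all factors are local members of \<open>I\<close>. With at most one dead vertex there is a
    live triangle, whose common sign accounts for two factors together with the fourth vertex: that
    vertex is dead, or it shares the sign because it completes further live triangles.\<close>
  have "?U i\<^sub>1 \<and> ?U i\<^sub>2 \<or> ?U i\<^sub>1 \<and> ?W i\<^sub>3 \<or> ?U i\<^sub>1 \<and> ?W i\<^sub>4 \<or>
      ?U i\<^sub>2 \<and> ?W i\<^sub>3 \<or> ?U i\<^sub>2 \<and> ?W i\<^sub>4 \<or> ?W i\<^sub>3 \<and> ?W i\<^sub>4"
  proof -
    have t: "?D i\<^sub>1 \<or> ?D i\<^sub>2 \<or> ?D i\<^sub>3 \<or> ?U i\<^sub>1 \<and> ?U i\<^sub>2 \<and> ?U i\<^sub>3 \<or> ?W i\<^sub>1 \<and> ?W i\<^sub>2 \<and> ?W i\<^sub>3"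
      "?D i\<^sub>1 \<or> ?D i\<^sub>2 \<or> ?D i\<^sub>4 \<or> ?U i\<^sub>1 \<and> ?U i\<^sub>2 \<and> ?U i\<^sub>4 \<or> ?W i\<^sub>1 \<and> ?W i\<^sub>2 \<and> ?W i\<^sub>4"
      "?D i\<^sub>1 \<or> ?D i\<^sub>3 \<or> ?D i\<^sub>4 \<or> ?U i\<^sub>1 \<and> ?U i\<^sub>3 \<and> ?U i\<^sub>4 \<or> ?W i\<^sub>1 \<and> ?W i\<^sub>3 \<and> ?W i\<^sub>4"
      "?D i\<^sub>2 \<or> ?D i\<^sub>3 \<or> ?D i\<^sub>4 \<or> ?U i\<^sub>2 \<and> ?U i\<^sub>3 \<and> ?U i\<^sub>4 \<or> ?W i\<^sub>2 \<and> ?W i\<^sub>3 \<and> ?W i\<^sub>4"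
      by (rule triangle; use distinct in simp)+
    then show ?thesis
      using dead[of i\<^sub>1] dead[of i\<^sub>2] dead[of i\<^sub>3] dead[of i\<^sub>4] by sat
  qed
  moreover have "p * q * r * s \<in> local_contraction P (I [^]\<^bsub>ideals_set xy_ring\<^esub> (2::nat))"
    if "{p, q} \<subseteq> local_contraction P I \<or> {p, r} \<subseteq> local_contraction P I \<or> {p, s} \<subseteq> local_contraction P I \<or>
      {q, r} \<subseteq> local_contraction P I \<or> {q, s} \<subseteq> local_contraction P I \<or> {r, s} \<subseteq> local_contraction P I"
    for p q r s
  proof -
    have "p * q * r * s = r * s * (p * q)" "p * q * r * s = q * s * (p * r)" "p * q * r * s = q * r * (p * s)"
      "p * q * r * s = p * s * (q * r)" "p * q * r * s = p * r * (q * s)" "p * q * r * s = p * q * (r * s)"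
      by (simp_all only: ac_simps)
    then show ?thesis
      using that local_contraction_mult_square[OF P I] by (metis insert_subset)
  qed
  ultimately show "clique_witness i\<^sub>1 i\<^sub>2 i\<^sub>3 i\<^sub>4 \<in> local_contraction P (I [^]\<^bsub>ideals_set xy_ring\<^esub> (2::nat))"
    unfolding clique_witness_def by simp
qed

text \<open>The evaluations \<open>\<epsilon> 1\<close> and \<open>\<epsilon> 0\<close> send the \<open>x\<close> variables of the first three clique vertices
  to \<open>\<tau>\<close>. They differ only at the \<open>y\<close> variable of the fourth, which goes to \<open>\<tau>\<close> and to \<open>0\<close>;
  all remaining variables go to \<open>0\<close>. As an edge joins different vertices, each generator has a
  term \<open>y\<^sub>i y\<^sub>j\<close> that both evaluations kill, hence equal images. The ideals \<open>B d\<close> of polynomials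
  whose two images vanish to order \<open>d\<close> and agree in degree \<open>d\<close> are multiplicative, so \<open>I\<^sup>2\<close> lies
  in \<open>B 4\<close>. The images of the witness are \<open>\<tau>\<^sup>4\<close> and \<open>0\<close>.\<close>

lemma clique_witness_notin_square:
  fixes E :: "'n::finite set set" and I :: "('n, 'k::field) xy_poly set"
  defines "I \<equiv> parity_binomial_edge_ideal E"
  assumes simple: "\<forall>e\<in>E. card e = 2" and distinct: "distinct [i\<^sub>1, i\<^sub>2, i\<^sub>3, i\<^sub>4]"
  shows "clique_witness i\<^sub>1 i\<^sub>2 i\<^sub>3 i\<^sub>4 \<notin> I [^]\<^bsub>ideals_set xy_ring\<^esub> (2::nat)"
proof -
  define c :: "'k \<Rightarrow> 'k Polynomial.poly" where "c = (\<lambda>r. [:r:])"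
  have c: "c 0 = 0" "c 1 = 1" "\<And>r s. c (r + s) = c r + c s" "\<And>r s. c (r * s) = c r * c s"
    by (auto simp: c_def one_pCons)
  define \<tau> :: "'k Polynomial.poly" where "\<tau> = [:0, 1:]"
  define a :: "'k \<Rightarrow> 'n + 'n \<Rightarrow> 'k Polynomial.poly" where
    "a = (\<lambda>t. case_sum (\<lambda>i. if i \<in> {i\<^sub>1, i\<^sub>2, i\<^sub>3} then \<tau> else 0) (\<lambda>i. if i = i\<^sub>4 then [:t:] * \<tau> else 0))"
  define \<epsilon> where "\<epsilon> t = mpoly_eval c (a t)" for t
  have ev_x: "\<epsilon> t (x_var i) = (if i \<in> {i\<^sub>1, i\<^sub>2, i\<^sub>3} then \<tau> else 0)" for t i
    unfolding \<epsilon>_def x_var_def by (subst mpoly_eval_var[OF c(1,2)]) (simp add: a_def)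
  have ev_y: "\<epsilon> t (y_var i) = (if i = i\<^sub>4 then [:t:] * \<tau> else 0)" for t i
    unfolding \<epsilon>_def y_var_def by (subst mpoly_eval_var[OF c(1,2)]) (simp add: a_def)
  have add: "\<epsilon> t (g + h) = \<epsilon> t g + \<epsilon> t h" and mult: "\<epsilon> t (g * h) = \<epsilon> t g * \<epsilon> t h" for t g h
    unfolding \<epsilon>_def by (rule mpoly_eval_add mpoly_eval_mult; use c in blast)+
  have zero: "\<epsilon> t 0 = 0" for t by (simp add: \<epsilon>_def mpoly_eval_def)
  have diff: "\<epsilon> t (g - h) = \<epsilon> t g - \<epsilon> t h" for t g h
    using add[of t "g - h" h] by (simp add: algebra_simps)
  have cross: "\<epsilon> 1 (g * h) - \<epsilon> 0 (g * h) = \<epsilon> 1 g * (\<epsilon> 1 h - \<epsilon> 0 h) + (\<epsilon> 1 g - \<epsilon> 0 g) * \<epsilon> 0 h" for g h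
    by (simp add: mult algebra_simps)
  \<comment> \<open>Both evaluations have the same constant term. This makes \<open>B 0\<close> the whole ring, so that the
    multiplicativity of \<open>B\<close> also shows that each \<open>B d\<close> is an ideal.\<close>
  have low: "\<tau> dvd \<epsilon> 1 g - \<epsilon> 0 g" for g
  proof (induction g rule: mpoly_induct)
    case (const r)
    show ?case using c by (simp add: \<epsilon>_def mpoly_eval_single)
  next
    case (var v)
    show ?case unfolding \<epsilon>_def mpoly_eval_var[OF c(1,2)] by (auto simp: a_def split: sum.splits)
  next
    case (add g h)
    have "\<epsilon> 1 (g + h) - \<epsilon> 0 (g + h) = (\<epsilon> 1 g - \<epsilon> 0 g) + (\<epsilon> 1 h - \<epsilon> 0 h)"
      by (simp add: \<open>\<And>t g h. \<epsilon> t (g + h) = \<epsilon> t g + \<epsilon> t h\<close>)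
    then show ?case using add by (simp add: dvd_add)
  next
    case (mult g h)
    then show ?case unfolding cross by (intro dvd_add dvd_mult dvd_mult2)
  qed
  define B where "B d = {g. \<tau> ^ d dvd \<epsilon> 0 g \<and> \<tau> ^ d dvd \<epsilon> 1 g \<and> \<tau> ^ Suc d dvd \<epsilon> 1 g - \<epsilon> 0 g}" for d
  have B_mult: "g * h \<in> B (d + e)" if "g \<in> B d" "h \<in> B e" for g h d e
  proof -
    have "\<tau> ^ d * \<tau> ^ Suc e dvd \<epsilon> 1 g * (\<epsilon> 1 h - \<epsilon> 0 h)" "\<tau> ^ Suc d * \<tau> ^ e dvd (\<epsilon> 1 g - \<epsilon> 0 g) * \<epsilon> 0 h"
      using that by (auto simp: B_def intro!: mult_dvd_mono simp del: power_Suc)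
    then have "\<tau> ^ Suc (d + e) dvd \<epsilon> 1 (g * h) - \<epsilon> 0 (g * h)"
      unfolding cross by (intro dvd_add) (simp_all add: power_add ac_simps)
    then show ?thesis
      using that by (auto simp: B_def mult power_add intro!: mult_dvd_mono)
  qed
  have B0: "g \<in> B 0" for g using low by (simp add: B_def)
  have B_ideal: "ideal (B d) xy_ring" for d
    unfolding ideal_type_ring_iff
  proof (intro conjI ballI allI)
    show "0 \<in> B d" by (simp add: B_def zero)
    fix g h assume "g \<in> B d"
    then show "h * g \<in> B d" using B_mult[OF B0] by simp
    assume "h \<in> B d"
    have "\<epsilon> 1 (g + h) - \<epsilon> 0 (g + h) = (\<epsilon> 1 g - \<epsilon> 0 g) + (\<epsilon> 1 h - \<epsilon> 0 h)" by (simp add: add)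
    then have "\<tau> ^ Suc d dvd \<epsilon> 1 (g + h) - \<epsilon> 0 (g + h)"
      using \<open>g \<in> B d\<close> \<open>h \<in> B d\<close> unfolding B_def by (metis (mono_tags, lifting) dvd_add mem_Collect_eq)
    then show "g + h \<in> B d" using \<open>g \<in> B d\<close> \<open>h \<in> B d\<close> by (simp add: B_def add dvd_add)
  qed
  have "I \<subseteq> B 2"
    unfolding I_def
  proof (rule parity_binomial_edge_ideal_subset[OF B_ideal])
    fix i j assume "{i, j} \<in> E"
    then have "i \<noteq> j" using simple by fastforce
    then show "x_var i * x_var j - y_var i * y_var j \<in> B 2"
      by (auto simp: B_def diff mult ev_x ev_y power2_eq_square)
  qed
  then have "I [^]\<^bsub>ideals_set xy_ring\<^esub> (2::nat) \<subseteq> B (2 + 2)"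
    using B_mult[of _ 2 _ 2] ideal_parity_binomial_edge_ideal[of E] B_ideal
    by (intro ideal_square_subset) (auto simp: I_def subset_iff simp del: numeral_plus_numeral)
  moreover have "clique_witness i\<^sub>1 i\<^sub>2 i\<^sub>3 i\<^sub>4 \<notin> B (2 + 2)"
  proof -
    have "\<epsilon> 1 (clique_witness i\<^sub>1 i\<^sub>2 i\<^sub>3 i\<^sub>4) - \<epsilon> 0 (clique_witness i\<^sub>1 i\<^sub>2 i\<^sub>3 i\<^sub>4) = \<tau> ^ 4"
      using distinct
      by (auto simp: clique_witness_def diff add mult ev_x ev_y power4_eq_xxxx)
    moreover have "\<not> \<tau> ^ 5 dvd \<tau> ^ 4"
    proof
      assume "\<tau> ^ 5 dvd \<tau> ^ 4"
      then have "degree (\<tau> ^ 5) \<le> degree (\<tau> ^ 4)" by (intro dvd_imp_degree_le) (auto simp: \<tau>_def)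
      then show False by (simp add: degree_power_eq \<tau>_def)
    qed
    ultimately show ?thesis by (auto simp: B_def)
  qed
  ultimately show ?thesis by blast
qed

lemma clique_four_exists:
  fixes E :: "'n::finite set set"
  assumes "clique_number E > 3"
  obtains i\<^sub>1 i\<^sub>2 i\<^sub>3 i\<^sub>4 where "distinct [i\<^sub>1, i\<^sub>2, i\<^sub>3, i\<^sub>4]" "clique {i\<^sub>1, i\<^sub>2, i\<^sub>3, i\<^sub>4} E"
proof -
  have "clique_number E \<in> card ` {C. clique C E}"
    unfolding clique_number_def by (rule Max_in) (auto intro: exI[of _ "{}"])
  then obtain C where C: "clique C E" "4 \<le> card C" using assms by auto
  obtain D where D: "D \<subseteq> C" "card D = 4" using C(2) obtain_subset_with_card_n by metis
  obtain xs where xs: "set xs = D" "distinct xs"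
    using finite_distinct_list[of D] by auto
  then have "length xs = 4" using D distinct_card by metis
  then obtain i\<^sub>1 i\<^sub>2 i\<^sub>3 i\<^sub>4 where "xs = [i\<^sub>1, i\<^sub>2, i\<^sub>3, i\<^sub>4]"
    by (auto simp: numeral_eq_Suc length_Suc_conv)
  then show thesis using that[of i\<^sub>1 i\<^sub>2 i\<^sub>3 i\<^sub>4] xs smaller_clique[OF C(1) D(1)] by auto
qed

theorem theorem2p5:
  fixes E :: "'n::finite set set"
    and I :: "('n, 'k::field) xy_poly set"
  assumes simple: "\<forall>e\<in>E. card e = 2"
    and char: "CHAR('k) \<noteq> 2"
    and I_def: "I = parity_binomial_edge_ideal E"
    and symbolic: "\<forall>t::nat. t \<ge> 1 \<longrightarrow> symbolic_power xy_ring I t = I [^]\<^bsub>ideals_set xy_ring\<^esub> t"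
  shows "clique_number E \<le> 3"
proof (rule ccontr)
  assume "\<not> clique_number E \<le> 3"
  then obtain i\<^sub>1 i\<^sub>2 i\<^sub>3 i\<^sub>4 where i: "distinct [i\<^sub>1, i\<^sub>2, i\<^sub>3, i\<^sub>4]" "clique {i\<^sub>1, i\<^sub>2, i\<^sub>3, i\<^sub>4} E"
    using clique_four_exists[of E] by (metis not_le)
  have "clique_witness i\<^sub>1 i\<^sub>2 i\<^sub>3 i\<^sub>4 \<in> symbolic_power xy_ring I 2"
    unfolding I_def by (rule clique_witness_in_symbolic_square[OF simple char i(2,1)])
  moreover have "clique_witness i\<^sub>1 i\<^sub>2 i\<^sub>3 i\<^sub>4 \<notin> I [^]\<^bsub>ideals_set xy_ring\<^esub> (2::nat)"
    unfolding I_def by (rule clique_witness_notin_square[OF simple i(1)])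
  ultimately show False using symbolic by auto
qed

end
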